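(* Let $G$ be a connected graph on $n$ vertices with exactly $p$ pendent vertices. Then: (1) If $n-p=1$, then $ABC(G)=ABC(S_n)=\sqrt{(n-1)(n-2)}$. (2) If $n-p=2$, then $ABC(G)\leq (n-3)\sqrt{\frac{n-3}{n-2}}+\sqrt{2}$, with equality if and only if $G\cong G'$, where $G'$ is the graph obtained from a path on three vertices by attaching $n-3$ pendent edges to one end vertex of the path. (3) If $n-p>2$, then $$ABC(G)\leq p\sqrt{\frac{n-2}{n-1}}+(n-p-1)\sqrt{\frac{2n-p-4}{(n-1)(n-p-1)}}+\frac{(n-p-1)(n-p-2)}{2}\sqrt{\frac{2n-2p-4}{(n-p-1)^{2}}},$$ with equality if and only if $G\cong K_n^p$, the graph obtained by attaching $p$ pendent edges to one vertex of the complete graph $K_{n-p}$.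
   Context: For a simple graph $G$, $ABC(G)=\sum_{uv\in E(G)}\sqrt{\frac{d(u)+d(v)-2}{d(u)d(v)}}$, where $d(u)$ is the degree of $u$. A pendent vertex is a vertex of degree $1$; attaching a pendent edge to a vertex $v$ means adding a new vertex adjacent only to $v$. $S_n$ is the star on $n$ vertices. *)

theory Defs
  imports Complex_Main
begin

definition simple_graph :: "'a set \<Rightarrow> ('a \<Rightarrow> 'a \<Rightarrow> bool) \<Rightarrow> bool" where
  "simple_graph V E \<longleftrightarrow> finite V \<and> (\<forall>u v. E u v \<longrightarrow> u \<in> V \<and> v \<in> V)
     \<and> (\<forall>u v. E u v \<longrightarrow> E v u) \<and> (\<forall>u. \<not> E u u)"

definition connected_graph :: "'a set \<Rightarrow> ('a \<Rightarrow> 'a \<Rightarrow> bool) \<Rightarrow> bool" where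
  "connected_graph V E \<longleftrightarrow> (\<forall>u\<in>V. \<forall>v\<in>V. E\<^sup>*\<^sup>* u v)"

definition degree :: "'a set \<Rightarrow> ('a \<Rightarrow> 'a \<Rightarrow> bool) \<Rightarrow> 'a \<Rightarrow> nat" where
  "degree V E v = card {u \<in> V. E v u}"

definition pendent_vertices :: "'a set \<Rightarrow> ('a \<Rightarrow> 'a \<Rightarrow> bool) \<Rightarrow> 'a set" where
  "pendent_vertices V E = {v \<in> V. degree V E v = 1}"

definition edges :: "'a set \<Rightarrow> ('a \<Rightarrow> 'a \<Rightarrow> bool) \<Rightarrow> 'a set set" where
  "edges V E = {{u, v} | u v. u \<in> V \<and> v \<in> V \<and> E u v}"

text \<open>Atom-bond connectivity index: for an edge e = {u,v} (u \<noteq> v),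
  the sum of degrees over e is d(u)+d(v) and the product is d(u)d(v).\<close>
definition ABC :: "'a set \<Rightarrow> ('a \<Rightarrow> 'a \<Rightarrow> bool) \<Rightarrow> real" where
  "ABC V E = (\<Sum>e\<in>edges V E.
      sqrt ((real (\<Sum>v\<in>e. degree V E v) - 2) / real (\<Prod>v\<in>e. degree V E v)))"

definition graph_iso :: "'a set \<Rightarrow> ('a \<Rightarrow> 'a \<Rightarrow> bool) \<Rightarrow> 'b set \<Rightarrow> ('b \<Rightarrow> 'b \<Rightarrow> bool) \<Rightarrow> bool" where
  "graph_iso V E W F \<longleftrightarrow> (\<exists>f. bij_betw f V W \<and> (\<forall>u\<in>V. \<forall>v\<in>V. E u v \<longleftrightarrow> F (f u) (f v)))"

definition star_adj :: "nat \<Rightarrow> nat \<Rightarrow> nat \<Rightarrow> bool" where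
  "star_adj n u v \<longleftrightarrow> u < n \<and> v < n \<and> u \<noteq> v \<and> (u = 0 \<or> v = 0)"

definition Gprime_adj :: "nat \<Rightarrow> nat \<Rightarrow> nat \<Rightarrow> bool" where
  "Gprime_adj n u v \<longleftrightarrow> u < n \<and> v < n \<and>
     ({u, v} = {0, 1} \<or> {u, v} = {1, 2} \<or> (u = 0 \<and> 3 \<le> v) \<or> (v = 0 \<and> 3 \<le> u))"

definition Knp_adj :: "nat \<Rightarrow> nat \<Rightarrow> nat \<Rightarrow> nat \<Rightarrow> bool" where
  "Knp_adj n p u v \<longleftrightarrow> u < n \<and> v < n \<and> u \<noteq> v \<and>
     ((u < n - p \<and> v < n - p) \<or> (u = 0 \<and> n - p \<le> v) \<or> (v = 0 \<and> n - p \<le> u))"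

end

theory Submission
  imports Defs
begin

text \<open>
  Write \<open>w x y = sqrt ((x + y - 2) / (x y))\<close> and let the core consist of the \<open>c + 1\<close> non-pendent
  vertices, vertex \<open>i\<close> carrying \<open>q i\<close> pendent edges; the \<open>q i\<close> add up to \<open>p\<close>.

  For \<open>c \<ge> 2\<close>, completing the core increases the index. Raising degrees from \<open>d\<close> to \<open>D\<close> costs a core
  edge at most \<open>1 / sqrt d - 1 / sqrt D\<close> at each of its ends, hence less than \<open>(D - d) / (2 sqrt D)\<close>
  per vertex, while a new edge gains at least \<open>(1 / sqrt X + 1 / sqrt Y) / 2\<close>, which is the same
  amount in total. In the complete core every term is bounded separately: \<open>w x 1\<close> increases with
  \<open>x\<close>, and \<open>w (c + s) (c + t) \<le> w (c + s + t) c\<close> lies below the secant of the convex function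
  \<open>w (c + \<cdot>) c\<close> between \<open>0\<close> and \<open>p\<close>, which is attained when all pendent edges share one vertex.

  For \<open>c = 1\<close> the graph is a double star, and one uses the convexity of \<open>x sqrt (x / (x + 1))\<close>.
\<close>

section \<open>The weight of an edge\<close>

definition abc_weight :: "real \<Rightarrow> real \<Rightarrow> real" where
  "abc_weight x y = sqrt ((x + y - 2) / (x * y))"

lemma abc_weight_commute: "abc_weight x y = abc_weight y x"
  by (simp add: abc_weight_def algebra_simps)

lemma abc_weight_nonneg: "x \<ge> 1 \<Longrightarrow> y \<ge> 1 \<Longrightarrow> abc_weight x y \<ge> 0"
  by (simp add: abc_weight_def)

lemma abc_weight_eq:
  assumes "x \<ge> 1" "y \<ge> 1"
  shows "abc_weight x y = sqrt (1 / x + (1 - 2 / x) / y)"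
proof -
  have "(x + y - 2) / (x * y) = 1 / x + (1 - 2 / x) / y"
    using assms by (simp add: field_simps)
  then show ?thesis by (simp add: abc_weight_def)
qed

lemma abc_weight_ge_inverse_sqrt:
  assumes "x \<ge> 2" "y \<ge> 1"
  shows "1 / sqrt x \<le> abc_weight x y"
proof -
  have "sqrt (1 / x) \<le> sqrt (1 / x + (1 - 2 / x) / y)"
    using assms by (intro real_sqrt_le_mono) (simp add: field_simps)
  then show ?thesis using assms by (simp add: abc_weight_eq real_sqrt_divide)
qed

lemma abc_weight_le_inverse_sqrt:
  assumes "1 \<le> x" "x \<le> 2" "y \<ge> 1"
  shows "abc_weight x y \<le> 1 / sqrt x"
proof -
  have "sqrt (1 / x + (1 - 2 / x) / y) \<le> sqrt (1 / x)"
    using assms by (intro real_sqrt_le_mono) (simp add: divide_le_0_iff field_simps)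
  then show ?thesis using assms by (simp add: abc_weight_eq real_sqrt_divide)
qed

lemma abc_weight_diff_le:
  assumes "1 \<le> x" "x \<le> X" "2 \<le> X" "1 \<le> y"
  shows "abc_weight x y - abc_weight X y \<le> 1 / sqrt x - 1 / sqrt X"
proof (cases "x \<le> 2")
  case True
  then show ?thesis
    using abc_weight_le_inverse_sqrt[of x y] abc_weight_ge_inverse_sqrt[of X y] assms by linarith
next
  case False
  define r R u U where "r = 1 / sqrt x" "R = 1 / sqrt X" "u = abc_weight x y" "U = abc_weight X y"
  note defs = this
  have le: "r \<le> u" "R \<le> U"
    using abc_weight_ge_inverse_sqrt False assms by (auto simp: defs)
  have pos: "0 < r" "0 < R" using assms by (auto simp: defs)
  have rR: "R \<le> r" using assms by (simp add: defs frac_le)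
  have sq: "u\<^sup>2 - U\<^sup>2 = (1 - 2 / y) * (r\<^sup>2 - R\<^sup>2)"
  proof -
    have "u\<^sup>2 = 1 / y + (1 - 2 / y) / x" "U\<^sup>2 = 1 / y + (1 - 2 / y) / X"
      using assms False
      by (simp_all add: defs abc_weight_def field_simps)
    moreover have "r\<^sup>2 = 1 / x" "R\<^sup>2 = 1 / X" using assms by (auto simp: defs power_divide)
    ultimately show ?thesis by (simp add: algebra_simps diff_divide_distrib)
  qed
  have "r\<^sup>2 - R\<^sup>2 \<ge> 0" using rR pos by (simp add: power_mono)
  then have "(1 - 2 / y) * (r\<^sup>2 - R\<^sup>2) \<le> 1 * (r\<^sup>2 - R\<^sup>2)"
    using assms by (intro mult_right_mono) auto
  then have main: "(u - U) * (u + U) \<le> (r - R) * (r + R)"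
    using sq by (simp add: power2_eq_square algebra_simps)
  have "u - U \<le> r - R"
  proof (rule ccontr)
    assume "\<not> u - U \<le> r - R"
    then have "(r - R) * (r + R) < (u - U) * (u + U)"
      using le pos rR by (intro mult_strict_mono' mult_less_le_imp_less) auto
    then show False using main by simp
  qed
  then show ?thesis by (simp add: defs)
qed

lemma abc_weight_ge_mean:
  assumes "X \<ge> 2" "Y \<ge> 2"
  shows "(1 / sqrt X + 1 / sqrt Y) / 2 \<le> abc_weight X Y"
proof -
  have "(sqrt X + sqrt Y)\<^sup>2 \<le> 2 * (X + Y)"
    using sum_squares_bound[of "sqrt X" "sqrt Y"] assms by (simp add: power2_sum)
  then have "((sqrt X + sqrt Y) / 2)\<^sup>2 \<le> X + Y - 2"
    using assms by (simp add: power_divide)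
  then have "(sqrt X + sqrt Y) / 2 \<le> sqrt (X + Y - 2)"
    by (rule real_le_rsqrt)
  then have "(sqrt X + sqrt Y) / 2 / (sqrt X * sqrt Y) \<le> sqrt (X + Y - 2) / (sqrt X * sqrt Y)"
    using assms by (intro divide_right_mono) auto
  also have "\<dots> = abc_weight X Y"
    by (simp add: abc_weight_def real_sqrt_divide real_sqrt_mult)
  finally show ?thesis using assms by (simp add: field_simps)
qed

lemma mult_diff_inverse_sqrt_le:
  assumes "0 \<le> e" "e \<le> d" "d \<le> D" "0 < D"
  shows "e * (1 / sqrt d - 1 / sqrt D) \<le> (D - d) / (2 * sqrt D)"
    and "d < D \<Longrightarrow> e * (1 / sqrt d - 1 / sqrt D) < (D - d) / (2 * sqrt D)"
proof -
  define s S where "s = sqrt d" "S = sqrt D"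
  have dD: "d = s\<^sup>2" "D = S\<^sup>2" "S > 0" "s \<ge> 0" "s \<le> S" using assms by (auto simp: s_S_def)
  have *: "e * (1 / sqrt d - 1 / sqrt D) \<le> s - s\<^sup>2 / S"
  proof (cases "d = 0")
    case True
    then show ?thesis using assms dD by auto
  next
    case False
    then have "s > 0" using dD by auto
    have "e * (1 / sqrt d - 1 / sqrt D) \<le> d * (1 / sqrt d - 1 / sqrt D)"
      using assms False by (intro mult_right_mono) (auto simp: frac_le)
    also have "\<dots> = s - s\<^sup>2 / S"
      using \<open>s > 0\<close> \<open>S > 0\<close> unfolding s_S_def[symmetric] dD by (simp add: field_simps power2_eq_square)
    finally show ?thesis .
  qed
  have eq: "(D - d) / (2 * sqrt D) - (s - s\<^sup>2 / S) = (S - s)\<^sup>2 / (2 * S)"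
    unfolding s_S_def(2)[symmetric] unfolding dD(1,2) using \<open>S > 0\<close>
    by (simp add: field_simps power2_eq_square)
  have "(S - s)\<^sup>2 / (2 * S) \<ge> 0" using dD by simp
  then show "e * (1 / sqrt d - 1 / sqrt D) \<le> (D - d) / (2 * sqrt D)"
    using * eq by linarith
  assume "d < D"
  then have "s < S" by (simp add: s_S_def)
  then have "(S - s)\<^sup>2 / (2 * S) > 0" using \<open>S > 0\<close> by simp
  then show "e * (1 / sqrt d - 1 / sqrt D) < (D - d) / (2 * sqrt D)"
    using * eq by linarith
qed

lemma abc_weight_transfer_le:
  assumes "c \<ge> 1" "s \<ge> 0" "t \<ge> 0"
  shows "abc_weight (c + s) (c + t) \<le> abc_weight (c + (s + t)) c"
proof -
  have "(c + (s + t)) * c \<le> (c + s) * (c + t)" using assms by (simp add: algebra_simps)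
  then have "(c + s + (c + t) - 2) / ((c + s) * (c + t)) \<le> (c + (s + t) + c - 2) / ((c + (s + t)) * c)"
    using assms by (intro frac_le) (auto intro!: add_nonneg_pos mult_pos_pos)
  then show ?thesis by (simp add: abc_weight_def)
qed

lemma abc_weight_convex:
  assumes c: "c \<ge> 2" "x \<ge> 1" "y \<ge> 1" and l: "0 \<le> l" "l \<le> 1"
  shows "abc_weight ((1 - l) * x + l * y) c \<le> (1 - l) * abc_weight x c + l * abc_weight y c"
proof -
  define a b where "a = 1 / c" "b = 1 - 2 / c"
  have ab: "a > 0" "b \<ge> 0" using c by (auto simp: a_b_def)
  define u v where "u = sqrt x" "v = sqrt y"
  have uv: "u > 0" "v > 0" "u\<^sup>2 = x" "v\<^sup>2 = y" using c by (auto simp: u_v_def)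
  define A B where "A = abc_weight x c" "B = abc_weight y c"
  have w: "abc_weight z c = sqrt (a + b / z)" if "z \<ge> 1" for z
    using that c by (simp add: abc_weight_commute[of z] abc_weight_eq a_b_def)
  have z1: "(1 - l) * x + l * y \<ge> 1"
  proof -
    have "(1 - l) * 1 + l * 1 \<le> (1 - l) * x + l * y" using c l by (intro add_mono mult_left_mono) auto
    then show ?thesis by simp
  qed
  have A2: "A\<^sup>2 = a + b / x" "B\<^sup>2 = a + b / y"
    using ab c by (auto simp: A_B_def w)
  have AB0: "A \<ge> 0" "B \<ge> 0" using c by (auto simp: A_B_def abc_weight_nonneg)
  have AB: "A * B \<ge> a + b / (u * v)"
  proof -
    have "(a + b / (u * v))\<^sup>2 \<le> (A * B)\<^sup>2"
    proof -
      have "(A * B)\<^sup>2 - (a + b / (u * v))\<^sup>2 = a * b * (1 / u - 1 / v)\<^sup>2"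
        unfolding power_mult_distrib A2 uv(3,4)[symmetric] using uv(1,2)
        by (simp add: field_simps power2_eq_square)
      then show ?thesis using ab by (smt (verit) mult_nonneg_nonneg zero_le_power2)
    qed
    then show ?thesis using AB0 by (meson mult_nonneg_nonneg power2_le_imp_le)
  qed
  have h1: "1 / ((1 - l) * x + l * y) \<le> ((1 - l) / u + l / v)\<^sup>2"
  proof -
    define m where "m = (1 - l) * u + l * v"
    have m: "m > 0"
      unfolding m_def using l uv
      by (cases "l = 0") (auto intro: add_nonneg_pos)
    have "m\<^sup>2 \<le> (1 - l) * x + l * y"
    proof -
      have "(1 - l) * u\<^sup>2 + l * v\<^sup>2 - m\<^sup>2 = l * (1 - l) * (u - v)\<^sup>2"
        by (simp add: m_def algebra_simps power2_eq_square)
      moreover have "l * (1 - l) * (u - v)\<^sup>2 \<ge> 0" using l by simp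
      ultimately show ?thesis unfolding uv(3,4) by linarith
    qed
    then have "1 / ((1 - l) * x + l * y) \<le> 1 / m\<^sup>2" using m by (intro frac_le) auto
    also have "\<dots> = (1 / m)\<^sup>2" by (simp add: power_divide)
    also have "\<dots> \<le> ((1 - l) / u + l / v)\<^sup>2"
    proof (intro power_mono)
      have "((1 - l) / u + l / v) * m - 1 = l * (1 - l) * (u - v)\<^sup>2 / (u * v)"
        using uv(1,2) by (simp add: m_def field_simps power2_eq_square)
      moreover have "l * (1 - l) * (u - v)\<^sup>2 / (u * v) \<ge> 0" using l uv by simp
      ultimately have "((1 - l) / u + l / v) * m \<ge> 1" by linarith
      then show "1 / m \<le> (1 - l) / u + l / v" using m by (simp add: divide_le_eq)
    qed (use m in auto)
    finally show ?thesis .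
  qed
  have "a + b / ((1 - l) * x + l * y) \<le> a + b * ((1 - l) / u + l / v)\<^sup>2"
    using mult_left_mono[OF h1 ab(2)] by simp
  also have "\<dots> = (1 - l)\<^sup>2 * (a + b / u\<^sup>2) + l\<^sup>2 * (a + b / v\<^sup>2) + 2 * (l * (1 - l)) * (a + b / (u * v))"
    using uv(1,2) by (simp add: field_simps power2_eq_square)
  also have "\<dots> \<le> (1 - l)\<^sup>2 * A\<^sup>2 + l\<^sup>2 * B\<^sup>2 + 2 * (l * (1 - l)) * (A * B)"
    unfolding A2 uv(3,4) using l by (intro add_mono order.refl mult_left_mono AB) auto
  also have "\<dots> = ((1 - l) * A + l * B)\<^sup>2"
    by (simp add: algebra_simps power2_eq_square)
  finally have "sqrt (a + b / ((1 - l) * x + l * y)) \<le> (1 - l) * A + l * B"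
    using AB0 l by (intro real_le_lsqrt) auto
  then show ?thesis using z1 by (simp add: w A_B_def)
qed

lemma abc_weight_one_mono:
  assumes "1 \<le> x" "x \<le> y"
  shows "abc_weight x 1 \<le> abc_weight y 1"
  using assms by (simp add: abc_weight_def field_simps)

lemma abc_weight_one_strict_mono:
  assumes "1 \<le> x" "x < y"
  shows "abc_weight x 1 < abc_weight y 1"
  using assms by (simp add: abc_weight_def field_simps)

lemma abc_weight_spread_le:
  assumes "c \<ge> 2" "p > 0" "s \<ge> 0" "t \<ge> 0" "s + t \<le> p"
  shows "abc_weight (c + s) (c + t) \<le>
    abc_weight c c - (s + t) / p * (abc_weight c c - abc_weight (c + p) c)"
proof -
  define l where "l = (s + t) / p"
  have "c + (s + t) = (1 - l) * c + l * (c + p)"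
    using assms by (simp add: l_def field_simps)
  moreover have "abc_weight (c + s) (c + t) \<le> abc_weight (c + (s + t)) c"
    using assms by (intro abc_weight_transfer_le) auto
  moreover have "abc_weight ((1 - l) * c + l * (c + p)) c
      \<le> (1 - l) * abc_weight c c + l * abc_weight (c + p) c"
    using assms by (intro abc_weight_convex) (auto simp: l_def)
  ultimately have "abc_weight (c + s) (c + t) \<le> abc_weight c c - l * (abc_weight c c - abc_weight (c + p) c)"
    by (simp add: algebra_simps)
  then show ?thesis by (simp add: l_def)
qed

lemma sum_off_diagonal:
  fixes f :: "'a \<Rightarrow> 'b::comm_ring_1"
  assumes "finite C" "i \<in> C"
  shows "(\<Sum>j\<in>C. of_bool (i \<noteq> j) * f j) = sum f C - f i"
proof -
  have "(\<Sum>j\<in>C. of_bool (i \<noteq> j) * f j) = (\<Sum>j\<in>C - {i}. f j)"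
    using assms by (subst sum.remove[of C i]) (auto intro!: sum.cong)
  then show ?thesis using assms by (simp add: sum_diff1)
qed

lemma sum_abc_weight_complete_le:
  fixes q :: "'a \<Rightarrow> real"
  assumes C: "finite C" "real (card C) = c + 1" "c \<ge> 2" and q: "\<And>i. i \<in> C \<Longrightarrow> 0 \<le> q i"
  defines "p \<equiv> sum q C"
  shows "(\<Sum>i\<in>C. \<Sum>j\<in>C. of_bool (i \<noteq> j) * abc_weight (c + q i) (c + q j))
    \<le> 2 * (c * abc_weight (c + p) c + c * (c - 1) / 2 * abc_weight c c)"
proof -
  define A B where "A = abc_weight c c" "B = abc_weight (c + p) c"
  define r where "r = (A - B) / p"
  have p0: "p \<ge> 0" unfolding p_def by (intro sum_nonneg q)
  have qle: "q i + q j \<le> p" if "i \<in> C" "j \<in> C" "i \<noteq> j" for i j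
  proof -
    have "q i + q j = sum q {i, j}" using that by simp
    also have "\<dots> \<le> p" unfolding p_def using that C q by (intro sum_mono2) auto
    finally show ?thesis .
  qed
  have weight_le: "abc_weight (c + q i) (c + q j) \<le> A - r * (q i + q j)"
    if "i \<in> C" "j \<in> C" "i \<noteq> j" for i j
  proof (cases "p = 0")
    case True
    then have "q i = 0" "q j = 0" using qle[OF that] q that by (smt (verit))+
    then show ?thesis by (simp add: A_B_def)
  next
    case False
    then show ?thesis
      using abc_weight_spread_le[of c p "q i" "q j"] C p0 q that qle[OF that]
      by (simp add: r_def A_B_def mult.commute)
  qed
  have row: "(\<Sum>j\<in>C. of_bool (i \<noteq> j) * (A - r * (q i + q j)))
      = c * A - r * ((c - 1) * q i + p)" if "i \<in> C" for i
    using that C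
    by (subst sum_off_diagonal)
      (simp_all add: sum_subtractf sum_distrib_left[symmetric] sum.distrib p_def algebra_simps)
  have "(\<Sum>i\<in>C. \<Sum>j\<in>C. of_bool (i \<noteq> j) * abc_weight (c + q i) (c + q j))
     \<le> (\<Sum>i\<in>C. \<Sum>j\<in>C. of_bool (i \<noteq> j) * (A - r * (q i + q j)))"
    using weight_le by (intro sum_mono) auto
  also have "\<dots> = (\<Sum>i\<in>C. c * A - r * ((c - 1) * q i + p))"
    using row by (intro sum.cong) auto
  also have "\<dots> = (c + 1) * c * A - r * ((c - 1) * p + (c + 1) * p)"
    using C(2) by (simp add: sum_subtractf sum.distrib sum_distrib_left[symmetric] p_def[symmetric] algebra_simps)
  also have "\<dots> = (c + 1) * c * A - 2 * c * (r * p)" by (simp add: algebra_simps)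
  also have "r * p = A - B" by (cases "p = 0") (auto simp: r_def A_B_def)
  also have "(c + 1) * c * A - 2 * c * (A - B) = 2 * (c * B + c * (c - 1) / 2 * A)"
    by (simp add: field_simps)
  finally show ?thesis by (simp add: A_B_def)
qed

lemma sum_abc_weight_complete_concentrated:
  fixes q :: "'a \<Rightarrow> real"
  assumes C: "finite C" "real (card C) = c + 1" and z: "z \<in> C" "q z = p"
    and q: "\<And>i. i \<in> C \<Longrightarrow> i \<noteq> z \<Longrightarrow> q i = 0"
  shows "(\<Sum>i\<in>C. \<Sum>j\<in>C. of_bool (i \<noteq> j) * abc_weight (c + q i) (c + q j))
    = 2 * (c * abc_weight (c + p) c + c * (c - 1) / 2 * abc_weight c c)"
proof -
  define A B where "A = abc_weight c c" "B = abc_weight (c + p) c"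
  have cz: "real (card (C - {z})) = c"
    using card.remove[OF C(1) z(1)] C(2) by linarith
  have z_row: "(\<Sum>j\<in>C. of_bool (z \<noteq> j) * abc_weight (c + q z) (c + q j)) = c * B"
  proof -
    have "(\<Sum>j\<in>C. of_bool (z \<noteq> j) * abc_weight (c + q z) (c + q j)) = (\<Sum>j\<in>C - {z}. B)"
      unfolding sum.remove[OF C(1) z(1)] using z q by (auto intro!: sum.cong simp: A_B_def simp del: sum_constant)
    then show ?thesis using cz by simp
  qed
  have row: "(\<Sum>j\<in>C. of_bool (i \<noteq> j) * abc_weight (c + q i) (c + q j)) = B + (c - 1) * A"
    if i: "i \<in> C - {z}" for i
  proof -
    have "(\<Sum>j\<in>C. of_bool (i \<noteq> j) * abc_weight (c + q i) (c + q j))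
        = B + (\<Sum>j\<in>C - {z}. of_bool (i \<noteq> j) * A)"
      unfolding sum.remove[OF C(1) z(1)] using z q i
      by (auto intro!: arg_cong2[of _ _ _ _ "(+)"] sum.cong simp: A_B_def abc_weight_commute
          simp del: sum_constant sum_of_bool_mult_eq)
    then show ?thesis using i C(1) cz by (subst (asm) sum_off_diagonal) (simp_all add: algebra_simps)
  qed
  have "(\<Sum>i\<in>C. \<Sum>j\<in>C. of_bool (i \<noteq> j) * abc_weight (c + q i) (c + q j))
      = (\<Sum>j\<in>C. of_bool (z \<noteq> j) * abc_weight (c + q z) (c + q j))
        + (\<Sum>i\<in>C - {z}. \<Sum>j\<in>C. of_bool (i \<noteq> j) * abc_weight (c + q i) (c + q j))"
    by (rule sum.remove[OF C(1) z(1)])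
  also have "\<dots> = c * B + (\<Sum>i\<in>C - {z}. B + (c - 1) * A)"
    unfolding z_row using row by (intro arg_cong2[of _ _ _ _ "(+)"] sum.cong refl)
  also have "\<dots> = c * B + c * (B + (c - 1) * A)" using cz by simp
  also have "\<dots> = 2 * (c * B + c * (c - 1) / 2 * A)" by (simp add: field_simps)
  finally show ?thesis by (simp add: A_B_def)
qed

lemma sum_abc_weight_le_complete:
  fixes d D :: "'a \<Rightarrow> real"
  assumes C: "finite C" and sym: "\<And>i j. E i j \<Longrightarrow> E j i" and irr: "\<And>i. \<not> E i i"
    and e: "\<And>i. i \<in> C \<Longrightarrow> (\<Sum>j\<in>C. of_bool (E i j)) \<le> d i"
    and D: "\<And>i. i \<in> C \<Longrightarrow> D i = d i + (\<Sum>j\<in>C. of_bool (i \<noteq> j \<and> \<not> E i j))" "\<And>i. i \<in> C \<Longrightarrow> 2 \<le> D i"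
  shows "(\<Sum>i\<in>C. \<Sum>j\<in>C. of_bool (E i j) * abc_weight (d i) (d j))
      \<le> (\<Sum>i\<in>C. \<Sum>j\<in>C. of_bool (i \<noteq> j) * abc_weight (D i) (D j))" (is "?L \<le> ?R")
    and "i \<in> C \<Longrightarrow> j \<in> C \<Longrightarrow> i \<noteq> j \<Longrightarrow> \<not> E i j \<Longrightarrow>
      (\<Sum>i\<in>C. \<Sum>j\<in>C. of_bool (E i j) * abc_weight (d i) (d j))
      < (\<Sum>i\<in>C. \<Sum>j\<in>C. of_bool (i \<noteq> j) * abc_weight (D i) (D j))"
proof -
  define g where "g i = 1 / sqrt (d i) - 1 / sqrt (D i)" for i
  define e where "e i = (\<Sum>j\<in>C. of_bool (E i j) :: real)" for i
  define m where "m i = (\<Sum>j\<in>C. of_bool (i \<noteq> j \<and> \<not> E i j) :: real)" for i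
  have e0: "0 \<le> e i" for i by (simp add: e_def sum_nonneg)
  have m0: "0 \<le> m i" for i by (simp add: m_def sum_nonneg)
  have d1: "1 \<le> d i" if "i \<in> C" "j \<in> C" "E i j" for i j
  proof -
    have "of_bool (E i j) \<le> e i" unfolding e_def using that C by (intro member_le_sum) auto
    then show ?thesis using e[OF that(1)] that by (simp add: e_def)
  qed
  have edge: "abc_weight (d i) (d j) - abc_weight (D i) (D j) \<le> g i + g j"
    if "i \<in> C" "j \<in> C" "E i j" for i j
  proof -
    have *: "1 \<le> d i" "1 \<le> d j" "d i \<le> D i" "d j \<le> D j" "2 \<le> D i" "2 \<le> D j"
      using d1 that sym D m0 unfolding m_def by auto
    show ?thesis
      using abc_weight_diff_le[of "d i" "D i" "d j"] abc_weight_diff_le[of "d j" "D j" "D i"] *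
      by (simp add: g_def abc_weight_commute)
  qed
  have swap: "(\<Sum>i\<in>C. \<Sum>j\<in>C. of_bool (P i j) * (h i + h j)) = 2 * (\<Sum>i\<in>C. (\<Sum>j\<in>C. of_bool (P i j)) * h i)"
    if "\<And>i j. P i j = P j i" for P and h :: "'a \<Rightarrow> real"
  proof -
    have "(\<Sum>i\<in>C. \<Sum>j\<in>C. of_bool (P i j) * h j) = (\<Sum>i\<in>C. \<Sum>j\<in>C. of_bool (P i j) * h i)"
      by (subst sum.swap) (simp add: that)
    then show ?thesis by (simp add: algebra_simps sum.distrib sum_distrib_left)
  qed
  have "?R - ?L = (\<Sum>i\<in>C. \<Sum>j\<in>C. of_bool (i \<noteq> j \<and> \<not> E i j) * abc_weight (D i) (D j))
      - (\<Sum>i\<in>C. \<Sum>j\<in>C. of_bool (E i j) * (abc_weight (d i) (d j) - abc_weight (D i) (D j)))"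
    unfolding sum_subtractf[symmetric] using irr by (intro sum.cong) auto
  moreover have "(\<Sum>i\<in>C. \<Sum>j\<in>C. of_bool (E i j) * (abc_weight (d i) (d j) - abc_weight (D i) (D j)))
      \<le> (\<Sum>i\<in>C. \<Sum>j\<in>C. of_bool (E i j) * (g i + g j))"
    using edge by (intro sum_mono) auto
  moreover have "\<dots> = 2 * (\<Sum>i\<in>C. e i * g i)"
    unfolding e_def by (rule swap) (use sym in blast)
  moreover have "(\<Sum>i\<in>C. \<Sum>j\<in>C. of_bool (i \<noteq> j \<and> \<not> E i j) * (1 / sqrt (D i) / 2 + 1 / sqrt (D j) / 2))
      \<le> (\<Sum>i\<in>C. \<Sum>j\<in>C. of_bool (i \<noteq> j \<and> \<not> E i j) * abc_weight (D i) (D j))"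
    using abc_weight_ge_mean D(2) by (intro sum_mono) (auto simp: add_divide_distrib)
  moreover have "(\<Sum>i\<in>C. \<Sum>j\<in>C. of_bool (i \<noteq> j \<and> \<not> E i j) * (1 / sqrt (D i) / 2 + 1 / sqrt (D j) / 2))
      = 2 * (\<Sum>i\<in>C. m i * (1 / sqrt (D i) / 2))"
    unfolding m_def by (rule swap) (use sym in blast)
  ultimately have main: "2 * (\<Sum>i\<in>C. m i * (1 / sqrt (D i) / 2)) - 2 * (\<Sum>i\<in>C. e i * g i) \<le> ?R - ?L"
    by linarith
  have hyps: "0 \<le> e i" "e i \<le> d i" "d i \<le> D i" "0 < D i" "D i - d i = m i" if "i \<in> C" for i
    using assms(4)[OF that] e0[of i] m0[of i] D(1)[OF that] D(2)[OF that] by (auto simp: m_def e_def)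
  have le: "e i * g i \<le> m i * (1 / sqrt (D i) / 2)" if "i \<in> C" for i
    using mult_diff_inverse_sqrt_le(1)[OF hyps(1-4)[OF that]] hyps(5)[OF that]
    by (simp add: g_def mult.commute)
  then have "(\<Sum>i\<in>C. e i * g i) \<le> (\<Sum>i\<in>C. m i * (1 / sqrt (D i) / 2))" by (rule sum_mono)
  then show "?L \<le> ?R" using main by linarith
  assume ij: "i \<in> C" "j \<in> C" "i \<noteq> j" "\<not> E i j"
  have "of_bool (i \<noteq> j \<and> \<not> E i j) \<le> m i" unfolding m_def using ij C by (intro member_le_sum) auto
  then have "m i > 0" using ij by simp
  then have "e i * g i < m i * (1 / sqrt (D i) / 2)"
    using mult_diff_inverse_sqrt_le(2)[OF hyps(1-4)[OF ij(1)]] hyps(5)[OF ij(1)]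
    by (simp add: g_def mult.commute)
  then have "(\<Sum>i\<in>C. e i * g i) < (\<Sum>i\<in>C. m i * (1 / sqrt (D i) / 2))"
    using le ij C by (intro sum_strict_mono_ex1) auto
  then show "?L < ?R" using main by linarith
qed

text \<open>The contribution of \<open>x\<close> pendent edges at a vertex of degree \<open>x + 1\<close>.\<close>

definition star_sum :: "real \<Rightarrow> real" where
  "star_sum x = x * sqrt (x / (x + 1))"

lemma star_sum_ge_tangent:
  assumes "x \<ge> 0" "s \<ge> 0"
  shows "3 / 2 * s * x - s ^ 3 * (x + 1) / 2 \<le> star_sum x"
proof -
  define t where "t = sqrt (x / (x + 1))"
  have t: "t \<ge> 0" "t\<^sup>2 = x / (x + 1)" using assms by (auto simp: t_def)
  then have x: "x = t\<^sup>2 * (x + 1)" using assms by (simp add: field_simps)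
  \<comment> \<open>After division by \<open>x + 1\<close> the claim is \<open>2 t^3 - 3 s t^2 + s^3 \<ge> 0\<close>, and \<open>s\<close> is a double root in \<open>t\<close>.\<close>
  have "0 \<le> (t - s)\<^sup>2 * (2 * t + s) * ((x + 1) / 2)" using t assms by simp
  also have "\<dots> = t\<^sup>2 * (x + 1) * t - (3 / 2 * s * (t\<^sup>2 * (x + 1)) - s ^ 3 * (x + 1) / 2)"
    by (simp add: field_simps power2_eq_square power3_eq_cube)
  finally show ?thesis using x by (simp add: star_sum_def t_def[symmetric])
qed

lemma star_sum_split_le:
  assumes "a \<ge> 1" "b \<ge> 1"
  shows "star_sum a + star_sum b \<le> star_sum (a + b - 1) + star_sum 1"
proof (cases "a + b = 2")
  case True
  then have "a = 1" "b = 1" using assms by auto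
  then show ?thesis by simp
next
  case False
  define N where "N = a + b - 2"
  have N: "N > 0" using False assms by (simp add: N_def)
  have secant: "N * star_sum x \<le> (x - 1) * star_sum (N + 1) + (N + 1 - x) * star_sum 1"
    if x: "1 \<le> x" "x \<le> N + 1" for x
  proof -
    define s where "s = sqrt (x / (x + 1))"
    define L where "L y = 3 / 2 * s * y - s ^ 3 * (y + 1) / 2" for y
    have "s\<^sup>2 = x / (x + 1)" using x by (simp add: s_def)
    then have "s ^ 3 * (x + 1) = s * x" using x by (simp add: power3_eq_cube power2_eq_square field_simps)
    then have "star_sum x = L x" by (simp add: star_sum_def L_def s_def[symmetric])
    moreover have "N * L x = (x - 1) * L (N + 1) + (N + 1 - x) * L 1"
      by (simp add: L_def field_simps)
    moreover have "L (N + 1) \<le> star_sum (N + 1)" "L 1 \<le> star_sum 1"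
      unfolding L_def using N x by (intro star_sum_ge_tangent; simp add: s_def)+
    ultimately show ?thesis using x by (simp add: add_mono mult_left_mono)
  qed
  have "N * (star_sum a + star_sum b) \<le> N * (star_sum (N + 1) + star_sum 1)"
    using secant[of a] secant[of b] assms by (simp add: N_def algebra_simps)
  then show ?thesis using N by (simp add: N_def)
qed

lemma star_sum_eq_abc_weight: "a > 0 \<Longrightarrow> star_sum a = a * abc_weight (a + 1) 1"
  by (simp add: star_sum_def abc_weight_def)

lemma double_star_le:
  assumes "a \<ge> 1" "b \<ge> 1"
  shows "star_sum a + star_sum b + abc_weight (a + 1) (b + 1) \<le> star_sum (a + b - 1) + sqrt 2"
    and "star_sum a + star_sum b + abc_weight (a + 1) (b + 1) = star_sum (a + b - 1) + sqrt 2
      \<longleftrightarrow> a = 1 \<or> b = 1"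
proof -
  have half: "star_sum 1 + sqrt (1 / 2) = sqrt 2"
    by (simp add: star_sum_def real_sqrt_divide real_div_sqrt)
  have pos: "(a + 1) * (b + 1) > 0" using assms by simp
  have eq: "(a + 1) * (b + 1) = 2 * (a + b) + (a - 1) * (b - 1)" by (simp add: algebra_simps)
  have w: "abc_weight (a + 1) (b + 1) = sqrt ((a + b) / ((a + 1) * (b + 1)))"
    by (simp add: abc_weight_def)
  have prod: "(a - 1) * (b - 1) \<ge> 0" using assms by simp
  have le: "abc_weight (a + 1) (b + 1) \<le> sqrt (1 / 2)"
    unfolding w using pos eq prod by (simp add: divide_le_eq)
  have iff: "abc_weight (a + 1) (b + 1) = sqrt (1 / 2) \<longleftrightarrow> a = 1 \<or> b = 1"
  proof -
    have "abc_weight (a + 1) (b + 1) = sqrt (1 / 2) \<longleftrightarrow> (a + b) / ((a + 1) * (b + 1)) = 1 / 2"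
      unfolding w by (simp only: real_sqrt_eq_iff)
    also have "\<dots> \<longleftrightarrow> (a - 1) * (b - 1) = 0"
      using pos eq by (simp add: divide_eq_eq)
    finally show ?thesis by simp
  qed
  show "star_sum a + star_sum b + abc_weight (a + 1) (b + 1) \<le> star_sum (a + b - 1) + sqrt 2"
    using star_sum_split_le[OF assms] half le by linarith
  show "star_sum a + star_sum b + abc_weight (a + 1) (b + 1) = star_sum (a + b - 1) + sqrt 2
      \<longleftrightarrow> a = 1 \<or> b = 1"
  proof
    assume "star_sum a + star_sum b + abc_weight (a + 1) (b + 1) = star_sum (a + b - 1) + sqrt 2"
    then show "a = 1 \<or> b = 1" using star_sum_split_le[OF assms] half le iff by linarith
  next
    assume "a = 1 \<or> b = 1"
    then show "star_sum a + star_sum b + abc_weight (a + 1) (b + 1) = star_sum (a + b - 1) + sqrt 2"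
      using half iff by auto
  qed
qed

section \<open>Graphs and their cores\<close>

lemma ABC_ordered_pairs:
  assumes "simple_graph V E"
  shows "2 * ABC V E =
    (\<Sum>u\<in>V. \<Sum>v\<in>V. of_bool (E u v) * abc_weight (degree V E u) (degree V E v))"
proof -
  have fin: "finite V" and EV: "\<And>u v. E u v \<Longrightarrow> u \<in> V \<and> v \<in> V"
    and sym: "\<And>u v. E u v \<Longrightarrow> E v u" and irr: "\<And>u. \<not> E u u"
    using assms by (auto simp: simple_graph_def)
  define R where "R = {(u, v). E u v}"
  define h where "h = (\<lambda>(u, v). abc_weight (degree V E u) (degree V E v))"
  define g :: "'a \<times> 'a \<Rightarrow> 'a set" where "g = (\<lambda>(u, v). {u, v})"
  have RV: "R \<subseteq> V \<times> V" using EV by (auto simp: R_def)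
  have finR: "finite R" using RV fin by (meson finite_SigmaI finite_subset)
  have edges: "edges V E = g ` R" using EV by (auto simp: edges_def g_def R_def)
  have "(\<Sum>u\<in>V. \<Sum>v\<in>V. of_bool (E u v) * abc_weight (degree V E u) (degree V E v))
      = (\<Sum>x\<in>V \<times> V. of_bool (x \<in> R) * h x)"
    by (simp add: sum.cartesian_product R_def h_def case_prod_unfold)
  also have "\<dots> = (\<Sum>x\<in>R. h x)"
    using RV fin by (intro sum.mono_neutral_cong_right) auto
  also have "\<dots> = (\<Sum>e\<in>g ` R. \<Sum>x\<in>{x \<in> R. g x = e}. h x)"
    using finR by (intro sum.group[symmetric]) auto
  also have "\<dots> = (\<Sum>e\<in>g ` R. 2 * sqrt ((real (\<Sum>v\<in>e. degree V E v) - 2) / real (\<Prod>v\<in>e. degree V E v)))"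
  proof (rule sum.cong[OF refl])
    fix e assume "e \<in> g ` R"
    then obtain u v where uv: "E u v" "e = {u, v}" by (auto simp: g_def R_def)
    then have "u \<noteq> v" using irr by auto
    moreover have "{x \<in> R. g x = e} = {(u, v), (v, u)}"
      using uv sym by (auto simp: R_def g_def doubleton_eq_iff)
    ultimately show "(\<Sum>x\<in>{x \<in> R. g x = e}. h x)
        = 2 * sqrt ((real (\<Sum>v\<in>e. degree V E v) - 2) / real (\<Prod>v\<in>e. degree V E v))"
      using uv by (simp add: h_def abc_weight_commute[of "real (degree V E v)"]) (simp add: abc_weight_def)
  qed
  also have "\<dots> = 2 * ABC V E" by (simp add: ABC_def edges sum_distrib_left)
  finally show ?thesis by simp
qed

locale pendent_graph =
  fixes V :: "'a set" and E :: "'a \<Rightarrow> 'a \<Rightarrow> bool"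
  assumes simple: "simple_graph V E" and connected: "connected_graph V E"
    and not_all_pendent: "pendent_vertices V E \<noteq> V"
begin

abbreviation "P \<equiv> pendent_vertices V E"

definition core :: "'a set" where "core = V - P"

abbreviation d :: "'a \<Rightarrow> real" where "d v \<equiv> real (degree V E v)"

definition q :: "'a \<Rightarrow> nat" where "q i = card {u \<in> P. E i u}"

lemma finite_V: "finite V" and edge_in_V: "E u v \<Longrightarrow> u \<in> V" "E u v \<Longrightarrow> v \<in> V"
  and edge_sym: "E u v \<Longrightarrow> E v u" and edge_irrefl: "\<not> E u u"
  using simple by (auto simp: simple_graph_def)

lemma P_subset: "P \<subseteq> V" by (auto simp: pendent_vertices_def)

lemma finite_P: "finite P" and finite_core: "finite core"
  using finite_V P_subset by (auto simp: core_def intro: finite_subset)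

lemma V_eq: "V = core \<union> P" and core_P_disjoint: "core \<inter> P = {}"
  using P_subset by (auto simp: core_def)

lemma card_V: "card V = card core + card P"
  using V_eq card_Un_disjoint[OF finite_core finite_P core_P_disjoint] by simp

lemma closed_eq_V:
  assumes "x \<in> S" "S \<subseteq> V" and closed: "\<And>u v. u \<in> S \<Longrightarrow> E u v \<Longrightarrow> v \<in> S"
  shows "S = V"
proof (intro equalityI assms(2) subsetI)
  fix v assume "v \<in> V"
  then have "E\<^sup>*\<^sup>* x v" using connected assms by (auto simp: connected_graph_def)
  then show "v \<in> S" by induction (use assms(1) closed in auto)
qed

lemma pendent_unique: "u \<in> P \<Longrightarrow> E u v \<Longrightarrow> E u w \<Longrightarrow> v = w"
  using edge_in_V(2)[of u v] edge_in_V(2)[of u w]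
  by (simp add: pendent_vertices_def degree_def card_1_singleton_iff set_eq_iff) metis

lemma pendent_neighbour:
  assumes "u \<in> P"
  obtains v where "E u v"
proof -
  have "card {v \<in> V. E u v} = 1" using assms by (auto simp: pendent_vertices_def degree_def)
  then show ?thesis using that by (auto simp: card_1_singleton_iff)
qed

lemma pendent_neighbour_core:
  assumes "u \<in> P" "E u v"
  shows "v \<in> core"
proof (rule ccontr)
  assume "v \<notin> core"
  then have v: "v \<in> P" using edge_in_V assms by (auto simp: core_def)
  have "{u, v} = V"
    using assms v edge_in_V edge_sym[of u v] pendent_unique
    by (intro closed_eq_V[of u]) blast+
  then show False using assms(1) v not_all_pendent P_subset by auto
qed

lemma two_neighbours_core:
  assumes "E x u" "E x v" "u \<noteq> v"
  shows "x \<in> core"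
  using assms pendent_unique[of x u v] edge_in_V(1)[of x u] by (auto simp: core_def)

lemma core_nonempty: "core \<noteq> {}"
  using not_all_pendent P_subset by (auto simp: core_def)

lemma sum_q: "(\<Sum>i\<in>core. real (q i)) = real (card P)"
proof -
  have "(\<Sum>i\<in>core. real (q i)) = (\<Sum>i\<in>core. \<Sum>u\<in>P. of_bool (E i u))"
    using finite_P by (simp add: q_def Int_def)
  also have "\<dots> = (\<Sum>u\<in>P. \<Sum>i\<in>core. of_bool (E i u))" by (rule sum.swap)
  also have "\<dots> = (\<Sum>u\<in>P. 1)"
  proof (rule sum.cong[OF refl])
    fix u assume u: "u \<in> P"
    obtain v where v: "E u v" using u by (rule pendent_neighbour)
    have "core \<inter> {i. E i u} = {v}"
      using v u pendent_neighbour_core pendent_unique edge_sym by blast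
    then show "(\<Sum>i\<in>core. of_bool (E i u)) = (1 :: real)" using finite_core by simp
  qed
  finally show ?thesis by simp
qed

lemma degree_split: "d i = real (q i) + (\<Sum>j\<in>core. of_bool (E i j))"
proof -
  have "{u \<in> V. E i u} = {u \<in> P. E i u} \<union> {j \<in> core. E i j}" using P_subset by (auto simp: core_def)
  moreover have "{u \<in> P. E i u} \<inter> {j \<in> core. E i j} = {}" using core_P_disjoint by auto
  ultimately have "degree V E i = card {u \<in> P. E i u} + card {j \<in> core. E i j}"
    unfolding degree_def using finite_core finite_P by (simp add: card_Un_disjoint)
  then show ?thesis using finite_core by (simp add: q_def Int_def)
qed

lemma ABC_core:
  "ABC V E = (\<Sum>i\<in>core. \<Sum>j\<in>core. of_bool (E i j) * abc_weight (d i) (d j)) / 2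
    + (\<Sum>i\<in>core. real (q i) * abc_weight (d i) 1)"
proof -
  define F where "F u v = of_bool (E u v) * abc_weight (d u) (d v)" for u v
  have split: "sum h V = sum h core + sum h P" for h :: "'a \<Rightarrow> real"
    using sum.union_disjoint[OF finite_core finite_P core_P_disjoint, of h] V_eq by simp
  have PP: "(\<Sum>u\<in>P. \<Sum>v\<in>P. F u v) = 0"
    using pendent_neighbour_core by (intro sum.neutral ballI) (auto simp: F_def core_def)
  have F_sym: "F u v = F v u" for u v
    using edge_sym by (auto simp: F_def abc_weight_commute)
  have PC: "(\<Sum>u\<in>P. \<Sum>i\<in>core. F u i) = (\<Sum>i\<in>core. \<Sum>u\<in>P. F i u)"
    by (subst sum.swap) (simp add: F_sym)
  have row: "(\<Sum>u\<in>P. F i u) = real (q i) * abc_weight (d i) 1" for i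
  proof -
    have "(\<Sum>u\<in>P. F i u) = (\<Sum>u\<in>P. of_bool (E i u) * abc_weight (d i) 1)"
      by (intro sum.cong) (auto simp: F_def pendent_vertices_def)
    then show ?thesis using finite_P by (simp add: sum_distrib_right[symmetric] q_def Int_def del: sum_of_bool_mult_eq)
  qed
  have "2 * ABC V E = (\<Sum>u\<in>V. \<Sum>v\<in>V. F u v)"
    unfolding F_def by (rule ABC_ordered_pairs[OF simple])
  also have "\<dots> = (\<Sum>i\<in>core. \<Sum>j\<in>core. F i j) + 2 * (\<Sum>i\<in>core. \<Sum>u\<in>P. F i u)"
    by (simp add: split sum.distrib PP PC)
  finally show ?thesis by (simp add: row) (simp add: F_def)
qed

lemma singleton_core:
  assumes "card core = 1"
  shows "ABC V E = sqrt ((real (card V) - 1) * (real (card V) - 2))" "card V \<noteq> 2"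
proof -
  obtain x where x: "core = {x}" using assms by (auto simp: card_1_singleton_iff)
  have qx: "real (q x) = card P" using sum_q by (simp add: x)
  have dx: "d x = real (card P)" using degree_split[of x] edge_irrefl qx by (simp add: x)
  define p where "p = real (card P)"
  have n: "real (card V) = p + 1" using card_V assms by (simp add: p_def)
  have "x \<notin> P" "x \<in> V" using x by (auto simp: core_def)
  then have "p \<noteq> 1" using dx by (auto simp: pendent_vertices_def p_def)
  then show "card V \<noteq> 2" using n by auto
  have "ABC V E = p * abc_weight p 1" using ABC_core edge_irrefl by (simp add: x qx dx p_def)
  also have "\<dots> = sqrt (p * (p - 1))"
  proof (cases "p = 0")
    case False
    then have "p > 0" by (simp add: p_def)
    then have "p * sqrt ((p - 1) / p) = sqrt (p\<^sup>2 * ((p - 1) / p))" by (simp only: real_sqrt_mult real_sqrt_abs abs_of_pos)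
    also have "p\<^sup>2 * ((p - 1) / p) = p * (p - 1)" using False by (simp add: power2_eq_square)
    finally show ?thesis by (simp add: abc_weight_def)
  qed simp
  finally show "ABC V E = sqrt ((real (card V) - 1) * (real (card V) - 2))" by (simp add: n)
qed

lemma double_core:
  assumes "core = {x, y}" "x \<noteq> y"
  shows "E x y" "q x \<ge> 1" "q y \<ge> 1" "card P = q x + q y"
    "ABC V E = star_sum (q x) + star_sum (q y) + abc_weight (real (q x) + 1) (real (q y) + 1)"
proof -
  show xy: "E x y"
  proof (rule ccontr)
    assume "\<not> E x y"
    then have "insert x {u \<in> P. E x u} = V"
      using edge_in_V[of x] edge_sym pendent_unique P_subset assms V_eq edge_irrefl
      by (intro closed_eq_V[of x]) blast+
    moreover have "y \<in> V" "y \<notin> P" using assms by (auto simp: core_def)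
    ultimately show False using assms by auto
  qed
  have d: "d x = real (q x) + 1" "d y = real (q y) + 1"
    using degree_split[of x] degree_split[of y] xy edge_sym[of x y] edge_irrefl assms by auto
  have "x \<in> V" "x \<notin> P" "y \<in> V" "y \<notin> P" using assms by (auto simp: core_def)
  then have "degree V E x \<noteq> 1" "degree V E y \<noteq> 1" by (auto simp: pendent_vertices_def)
  then show q: "q x \<ge> 1" "q y \<ge> 1" using d by (auto simp: not_less_eq_eq)
  show "card P = q x + q y" using sum_q assms by (simp flip: of_nat_add)
  show "ABC V E = star_sum (q x) + star_sum (q y) + abc_weight (real (q x) + 1) (real (q y) + 1)"
    using ABC_core assms xy edge_sym[of x y] edge_irrefl q
    by (simp add: d star_sum_eq_abc_weight abc_weight_commute)
qed

lemma double_core_ABC_le: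
  assumes "card core = 2"
  defines "n \<equiv> real (card V)"
  shows "ABC V E \<le> (n - 3) * sqrt ((n - 3) / (n - 2)) + sqrt 2"
    and "ABC V E = (n - 3) * sqrt ((n - 3) / (n - 2)) + sqrt 2
      \<longleftrightarrow> (\<exists>x y. core = {x, y} \<and> x \<noteq> y \<and> q y = 1)"
proof -
  obtain x y where xy: "core = {x, y}" "x \<noteq> y" using assms by (auto simp: card_2_iff)
  note * = double_core[OF xy]
  have "n = real (q x) + real (q y) + 2" using card_V assms *(4) by (simp add: n_def)
  then have bound: "(n - 3) * sqrt ((n - 3) / (n - 2)) = star_sum (real (q x) + real (q y) - 1)"
    by (simp add: star_sum_def)
  show "ABC V E \<le> (n - 3) * sqrt ((n - 3) / (n - 2)) + sqrt 2"
    using double_star_le(1)[of "q x" "q y"] * by (simp add: bound)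
  have "ABC V E = (n - 3) * sqrt ((n - 3) / (n - 2)) + sqrt 2 \<longleftrightarrow> q x = 1 \<or> q y = 1"
    using double_star_le(2)[of "q x" "q y"] * by (simp add: bound)
  also have "\<dots> \<longleftrightarrow> (\<exists>x y. core = {x, y} \<and> x \<noteq> y \<and> q y = 1)"
    using xy by (auto simp: doubleton_eq_iff)
  finally show "ABC V E = (n - 3) * sqrt ((n - 3) / (n - 2)) + sqrt 2
      \<longleftrightarrow> (\<exists>x y. core = {x, y} \<and> x \<noteq> y \<and> q y = 1)" .
qed

lemma q_le_card_P: "q i \<le> card P"
  unfolding q_def using finite_P by (intro card_mono) auto

lemma large_core_ABC_le:
  assumes k: "card core \<ge> 3"
  defines "c \<equiv> real (card core) - 1" and "p \<equiv> real (card P)"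
  defines "b \<equiv> p * abc_weight (c + p) 1 + c * abc_weight (c + p) c + c * (c - 1) / 2 * abc_weight c c"
  shows "ABC V E \<le> b"
    and "ABC V E = b \<longleftrightarrow>
      (\<forall>i\<in>core. \<forall>j\<in>core. i \<noteq> j \<longrightarrow> E i j) \<and> (\<exists>z\<in>core. \<forall>u\<in>P. E z u)"
proof -
  define D where "D i = c + real (q i)" for i
  have c2: "c \<ge> 2" using k by (simp add: c_def)
  have card_c: "real (card core) = c + 1" by (simp add: c_def)
  have D_eq: "D i = d i + (\<Sum>j\<in>core. of_bool (i \<noteq> j \<and> \<not> E i j))" if "i \<in> core" for i
  proof -
    have "(\<Sum>j\<in>core. of_bool (i \<noteq> j) * 1) = c"
      using sum_off_diagonal[OF finite_core that, of "\<lambda>_. 1::real"] card_c by simp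
    moreover have "(\<Sum>j\<in>core. of_bool (i \<noteq> j) * 1)
        = (\<Sum>j\<in>core. of_bool (E i j)) + (\<Sum>j\<in>core. of_bool (i \<noteq> j \<and> \<not> E i j) :: real)"
      unfolding sum.distrib[symmetric] using edge_irrefl by (intro sum.cong) auto
    ultimately show ?thesis using degree_split[of i] by (simp add: D_def)
  qed
  have dD: "d i \<le> D i" if "i \<in> core" for i
    using D_eq[OF that] sum_nonneg[of core "\<lambda>j. of_bool (i \<noteq> j \<and> \<not> E i j) :: real"] by simp
  have D_le: "D i \<le> c + p" for i using q_le_card_P[of i] by (simp add: D_def p_def)
  have dq: "real (q i) \<le> d i" for i
    using degree_split[of i] sum_nonneg[of core "\<lambda>j. of_bool (E i j) :: real"] by simp
  define S where "S = (\<Sum>i\<in>core. \<Sum>j\<in>core. of_bool (E i j) * abc_weight (d i) (d j))"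
  define T where "T = (\<Sum>i\<in>core. \<Sum>j\<in>core. of_bool (i \<noteq> j) * abc_weight (D i) (D j))"
  have e_le: "(\<Sum>j\<in>core. of_bool (E i j)) \<le> d i" for i using degree_split[of i] by simp
  have D2: "2 \<le> D i" for i using c2 by (simp add: D_def)
  note ST = sum_abc_weight_le_complete[of core E d D, OF finite_core edge_sym edge_irrefl e_le D_eq D2]
  have S_le_T: "S \<le> T" unfolding S_def T_def by (rule ST(1))
  have S_less_T: "S < T" if "i \<in> core" "j \<in> core" "i \<noteq> j" "\<not> E i j" for i j
    unfolding S_def T_def by (rule ST(2)[OF _ _ that])
  have T_le: "T / 2 \<le> c * abc_weight (c + p) c + c * (c - 1) / 2 * abc_weight c c"
    using sum_abc_weight_complete_le[OF finite_core card_c c2, of "\<lambda>i. real (q i)"]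
    by (simp add: T_def D_def sum_q p_def)
  have pend_term: "real (q i) * abc_weight (d i) 1 \<le> real (q i) * abc_weight (c + p) 1" if "i \<in> core" for i
  proof (cases "q i = 0")
    case False
    then have "1 \<le> d i" using dq[of i] by linarith
    moreover have "d i \<le> c + p" using dD[OF that] D_le[of i] by linarith
    ultimately show ?thesis by (intro mult_left_mono abc_weight_one_mono) auto
  qed simp
  have pend_sum: "(\<Sum>i\<in>core. real (q i) * abc_weight (c + p) 1) = p * abc_weight (c + p) 1"
    by (simp add: sum_distrib_right[symmetric] sum_q p_def)
  have pend_le: "(\<Sum>i\<in>core. real (q i) * abc_weight (d i) 1) \<le> p * abc_weight (c + p) 1"
    unfolding pend_sum[symmetric] using pend_term by (rule sum_mono)
  have ABC: "ABC V E = S / 2 + (\<Sum>i\<in>core. real (q i) * abc_weight (d i) 1)"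
    unfolding S_def by (rule ABC_core)
  show "ABC V E \<le> b"
    unfolding ABC b_def using S_le_T T_le pend_le by linarith
  show "ABC V E = b \<longleftrightarrow>
      (\<forall>i\<in>core. \<forall>j\<in>core. i \<noteq> j \<longrightarrow> E i j) \<and> (\<exists>z\<in>core. \<forall>u\<in>P. E z u)" (is "_ \<longleftrightarrow> ?complete \<and> ?centre")
  proof (intro iffI conjI)
    assume eq: "ABC V E = b"
    show ?complete
    proof (intro ballI impI, rule ccontr)
      fix i j assume "i \<in> core" "j \<in> core" "i \<noteq> j" "\<not> E i j"
      then have "S < T" by (rule S_less_T)
      then show False using eq T_le pend_le unfolding ABC b_def by linarith
    qed
    show ?centre
    proof (cases "P = {}")
      case True
      then show ?thesis using core_nonempty by auto
    next
      case False
      then obtain u z where u: "u \<in> P" "E u z" by (metis all_not_in_conv pendent_neighbour)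
      have z: "z \<in> core" using u by (rule pendent_neighbour_core)
      have "{u \<in> P. E z u} \<noteq> {}" using u edge_sym by auto
      then have qz: "q z > 0" using finite_P by (simp add: q_def card_gt_0_iff)
      have "d z \<ge> c + p"
      proof (rule ccontr)
        assume "\<not> d z \<ge> c + p"
        moreover have "1 \<le> d z" using dq[of z] qz by linarith
        ultimately have "real (q z) * abc_weight (d z) 1 < real (q z) * abc_weight (c + p) 1"
          using qz by (intro mult_strict_left_mono abc_weight_one_strict_mono) auto
        then have "(\<Sum>i\<in>core. real (q i) * abc_weight (d i) 1)
            < (\<Sum>i\<in>core. real (q i) * abc_weight (c + p) 1)"
          using z finite_core pend_term by (intro sum_strict_mono_ex1) auto
        then show False using eq S_le_T T_le unfolding ABC b_def pend_sum by linarith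
      qed
      then have "card P \<le> q z" using dD[OF z] by (simp add: D_def p_def)
      then have "{u \<in> P. E z u} = P"
        unfolding q_def using finite_P by (intro card_seteq) auto
      then show ?thesis using z by auto
    qed
  next
    assume struct: "?complete \<and> ?centre"
    then obtain z where z: "z \<in> core" "\<And>u. u \<in> P \<Longrightarrow> E z u" by auto
    have qz: "real (q z) = p"
    proof -
      have "{u \<in> P. E z u} = P" using z by auto
      then show ?thesis by (simp add: q_def p_def)
    qed
    have q0: "real (q i) = 0" if "i \<in> core" "i \<noteq> z" for i
    proof -
      have "{u \<in> P. E i u} = {}" using that z pendent_unique edge_sym by blast
      then show ?thesis unfolding q_def by (simp only: card.empty)
    qed
    have dD_eq: "d i = D i" if "i \<in> core" for i
    proof -
      have "E i j" if "j \<in> core" "i \<noteq> j" for j using struct \<open>i \<in> core\<close> that by blast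
      then have "(\<Sum>j\<in>core. of_bool (i \<noteq> j \<and> \<not> E i j) :: real) = 0"
        by (intro sum.neutral) auto
      then show ?thesis using D_eq[OF that] by simp
    qed
    have "S = T"
      unfolding S_def T_def using struct edge_irrefl dD_eq by (intro sum.cong) auto
    also have "T = 2 * (c * abc_weight (c + p) c + c * (c - 1) / 2 * abc_weight c c)"
      unfolding T_def D_def by (rule sum_abc_weight_complete_concentrated[where q = "\<lambda>i. real (q i)", OF finite_core card_c z(1) qz q0])
    finally have "S / 2 = c * abc_weight (c + p) c + c * (c - 1) / 2 * abc_weight c c" by simp
    moreover have "(\<Sum>i\<in>core. real (q i) * abc_weight (d i) 1) = p * abc_weight (c + p) 1"
      unfolding pend_sum[symmetric]
    proof (rule sum.cong[OF refl])
      fix i assume i: "i \<in> core"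
      then show "real (q i) * abc_weight (d i) 1 = real (q i) * abc_weight (c + p) 1"
        using q0[of i] qz dD_eq[OF i] by (cases "i = z") (auto simp: D_def)
    qed
    ultimately show "ABC V E = b" unfolding ABC b_def by simp
  qed
qed

section \<open>The extremal graphs\<close>

lemma iso_Gprime_iff:
  assumes k: "card core = 2" and n: "card V = n"
  shows "graph_iso V E {0..<n} (Gprime_adj n) \<longleftrightarrow> (\<exists>x y. core = {x, y} \<and> x \<noteq> y \<and> q y = 1)"
proof
  obtain a b where ab: "core = {a, b}" "a \<noteq> b" using k by (auto simp: card_2_iff)
  have n4: "n \<ge> 4" using double_core(2-4)[OF ab] card_V k n by simp
  assume "graph_iso V E {0..<n} (Gprime_adj n)"
  then obtain f where f: "bij_betw f V {0..<n}"
    "\<And>u v. u \<in> V \<Longrightarrow> v \<in> V \<Longrightarrow> E u v \<longleftrightarrow> Gprime_adj n (f u) (f v)"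
    by (auto simp: graph_iso_def)
  define g where "g = inv_into V f"
  have g: "g i \<in> V" "f (g i) = i" if "i < n" for i
    using f(1) that bij_betw_inv_into_right[OF f(1)] bij_betwE[OF bij_betw_inv_into[OF f(1)]]
    by (auto simp: g_def)
  have gf: "g (f u) = u" if "u \<in> V" for u
    using bij_betw_inv_into_left[OF f(1) that] by (simp add: g_def)
  have adj: "E (g i) (g j) \<longleftrightarrow> Gprime_adj n i j" if "i < n" "j < n" for i j
    using f(2) g that by simp
  have ne: "g i \<noteq> g j" if "i < n" "j < n" "i \<noteq> j" for i j using g that by metis
  have "g 0 \<in> core"
    by (rule two_neighbours_core[of _ "g 1" "g 3"]) (use adj ne n4 in \<open>auto simp: Gprime_adj_def\<close>)
  moreover have "g 1 \<in> core"
    by (rule two_neighbours_core[of _ "g 0" "g 2"]) (use adj ne n4 in \<open>auto simp: Gprime_adj_def\<close>)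
  moreover have "g 0 \<noteq> g 1" using ne n4 by simp
  ultimately have core: "core = {g 0, g 1}" using ab by auto
  have "{u \<in> P. E (g 1) u} = {g 2}"
  proof (intro equalityI subsetI)
    fix u assume u: "u \<in> {u \<in> P. E (g 1) u}"
    then have uV: "u \<in> V" using P_subset by auto
    then have "f u < n" using f(1) by (auto dest: bij_betwE)
    moreover have "Gprime_adj n 1 (f u)" using u f(2)[of "g 1" u] uV g n4 by auto
    ultimately have "f u = 0 \<or> f u = 2" by (auto simp: Gprime_adj_def doubleton_eq_iff)
    moreover have "u \<notin> core" using u core_P_disjoint by auto
    ultimately show "u \<in> {g 2}" using gf[OF uV] core by (metis insertI1)
  next
    fix u assume u: "u \<in> {g 2}"
    have "g 2 \<notin> core" "g 2 \<in> V" using core ne g n4 by auto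
    then have "g 2 \<in> P" by (simp add: core_def)
    moreover have "E (g 1) (g 2)" using adj n4 by (simp add: Gprime_adj_def)
    ultimately show "u \<in> {u \<in> P. E (g 1) u}" using u by simp
  qed
  then have "q (g 1) = 1" by (simp add: q_def)
  then show "\<exists>x y. core = {x, y} \<and> x \<noteq> y \<and> q y = 1" using core \<open>g 0 \<noteq> g 1\<close> by blast
next
  assume "\<exists>x y. core = {x, y} \<and> x \<noteq> y \<and> q y = 1"
  then obtain x y where xy: "core = {x, y}" "x \<noteq> y" "q y = 1" by auto
  obtain z where z: "{u \<in> P. E y u} = {z}" using xy(3) by (auto simp: q_def card_1_singleton_iff)
  have zP: "z \<in> P" "E y z" using z by auto
  have Exy: "E x y" using double_core(1)[OF xy(1,2)] .
  have xyP: "x \<notin> P" "y \<notin> P" "x \<in> V" "y \<in> V" using xy(1) by (auto simp: core_def)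
  have leaf: "E x u" "\<not> E y u" if u: "u \<in> P" "u \<noteq> z" for u
  proof -
    show "\<not> E y u" using u z by auto
    obtain v where "E u v" using u(1) by (rule pendent_neighbour)
    then have "E v u" "v = x \<or> v = y"
      using pendent_neighbour_core[OF u(1), of v] edge_sym xy(1) by auto
    then show "E x u" using \<open>\<not> E y u\<close> by auto
  qed
  have "\<not> E x z" using zP xy(2) pendent_unique[of z x y] edge_sym by blast
  have PP: "\<not> E u v" if "u \<in> P" "v \<in> P" for u v
    using that pendent_neighbour_core core_P_disjoint by blast
  have n4: "n = card (P - {z}) + 3" "n \<ge> 4"
    using double_core(2-4)[OF xy(1,2)] card_V k n zP finite_P by auto
  then have "card (P - {z}) = card {3..<n}" by simp
  then obtain h where h: "bij_betw h (P - {z}) {3..<n}"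
    using finite_P finite_same_card_bij[of "P - {z}" "{3..<n}"] by auto
  define f where "f u = (if u = x then 0 else if u = y then 1 else if u = z then 2 else h u)" for u
  have V: "V = {x, y, z} \<union> (P - {z})" using P_subset xy(1) zP by (auto simp: core_def)
  have xyz: "x \<noteq> z" "y \<noteq> z" using xyP zP by auto
  have fh: "f u = h u" if "u \<in> P - {z}" for u using that xyP by (auto simp: f_def)
  have hge: "h u \<ge> 3" "h u < n" if "u \<in> P - {z}" for u using bij_betwE[OF h] that by auto
  have f1: "bij_betw f {x, y, z} {0, 1, 2}"
    using xy(2) xyz by (auto simp: bij_betw_def f_def)
  have f2: "bij_betw f (P - {z}) {3..<n}"
    using h fh bij_betw_cong[of "P - {z}" f h] by blast
  have "bij_betw f ({x, y, z} \<union> (P - {z})) ({0, 1, 2} \<union> {3..<n})"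
    using f1 f2 by (rule bij_betw_combine) auto
  then have "bij_betw f V ({0, 1, 2} \<union> {3..<n})" by (simp only: V[symmetric])
  moreover have "{0, 1, 2} \<union> {3..<n} = {0..<n}" using n4 by auto
  moreover have "E u v \<longleftrightarrow> Gprime_adj n (f u) (f v)" if uv: "u \<in> V" "v \<in> V" for u v
  proof -
    have cases: "w = x \<or> w = y \<or> w = z \<or> w \<in> P - {z}" if "w \<in> V" for w using that V by auto
    have fv: "f x = 0" "f y = 1" "f z = 2" using xy(2) xyz by (auto simp: f_def)
    have adj: "E x y" "E y x" "E y z" "E z y" "\<not> E x z" "\<not> E z x" "\<not> E x x" "\<not> E y y" "\<not> E z z"
      using Exy zP(2) \<open>\<not> E x z\<close> edge_sym edge_irrefl by blast+
    have leaf': "E x w" "E w x" "\<not> E y w" "\<not> E w y" "\<not> E z w" "\<not> E w z" "f w \<ge> 3" "f w < n"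
      if "w \<in> P - {z}" for w
      using leaf[of w] that edge_sym PP zP(1) fh[OF that] hge[OF that] by auto
    show ?thesis
      using cases[OF uv(1)] cases[OF uv(2)]
    proof (elim disjE)
      assume "u \<in> P - {z}" "v \<in> P - {z}"
      then show ?thesis using PP leaf'(7)[of u] leaf'(7)[of v] by (auto simp: Gprime_adj_def doubleton_eq_iff)
    next
      assume "u \<in> P - {z}" "v = x"
      then show ?thesis using leaf'[of u] n4 by (auto simp: Gprime_adj_def doubleton_eq_iff fv)
    next
      assume "u \<in> P - {z}" "v = y"
      then show ?thesis using leaf'[of u] n4 by (auto simp: Gprime_adj_def doubleton_eq_iff fv)
    next
      assume "u \<in> P - {z}" "v = z"
      then show ?thesis using leaf'[of u] n4 by (auto simp: Gprime_adj_def doubleton_eq_iff fv)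
    next
      assume "v \<in> P - {z}" "u = x"
      then show ?thesis using leaf'[of v] n4 by (auto simp: Gprime_adj_def doubleton_eq_iff fv)
    next
      assume "v \<in> P - {z}" "u = y"
      then show ?thesis using leaf'[of v] n4 by (auto simp: Gprime_adj_def doubleton_eq_iff fv)
    next
      assume "v \<in> P - {z}" "u = z"
      then show ?thesis using leaf'[of v] n4 by (auto simp: Gprime_adj_def doubleton_eq_iff fv)
    qed (use adj n4 in \<open>simp_all add: Gprime_adj_def doubleton_eq_iff fv\<close>)
  qed
  ultimately show "graph_iso V E {0..<n} (Gprime_adj n)" by (auto simp: graph_iso_def)
qed

lemma iso_Knp_iff:
  assumes k: "card core \<ge> 3" and n: "card V = n" and p: "card P = p"
  shows "graph_iso V E {0..<n} (Knp_adj n p) \<longleftrightarrow>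
    (\<forall>i\<in>core. \<forall>j\<in>core. i \<noteq> j \<longrightarrow> E i j) \<and> (\<exists>z\<in>core. \<forall>u\<in>P. E z u)"
proof
  define m where "m = card core"
  have m: "n - p = m" "m \<ge> 3" "m \<le> n" using card_V k n p by (auto simp: m_def)
  {
    assume "graph_iso V E {0..<n} (Knp_adj n p)"
    then obtain f where f: "bij_betw f V {0..<n}"
      "\<And>u v. u \<in> V \<Longrightarrow> v \<in> V \<Longrightarrow> E u v \<longleftrightarrow> Knp_adj n p (f u) (f v)"
      by (auto simp: graph_iso_def)
    define g where "g = inv_into V f"
    have g: "g i \<in> V" "f (g i) = i" if "i < n" for i
      using f(1) that bij_betw_inv_into_right[OF f(1)] bij_betwE[OF bij_betw_inv_into[OF f(1)]]
      by (auto simp: g_def)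
    have gf: "g (f u) = u" if "u \<in> V" for u
      using bij_betw_inv_into_left[OF f(1) that] by (simp add: g_def)
    have adj: "E (g i) (g j) \<longleftrightarrow> Knp_adj n p i j" if "i < n" "j < n" for i j
      using f(2) g that by simp
    have ne: "g i \<noteq> g j" if "i < n" "j < n" "i \<noteq> j" for i j using g that by metis
    have clique: "E (g i) (g j)" if "i < m" "j < m" "i \<noteq> j" for i j
      using adj that m by (auto simp: Knp_adj_def)
    have "g i \<in> core" if i: "i < m" for i
    proof -
      obtain a b where "a < m" "b < m" "a \<noteq> i" "b \<noteq> i" "a \<noteq> b"
      proof -
        consider "i = 0" | "i = 1" | "i \<ge> 2" by linarith
        then show thesis
          using that[of 1 2] that[of 0 2] that[of 0 1] m by cases auto
      qed
      then show ?thesis using two_neighbours_core[OF clique clique, of i a b] ne i m by auto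
    qed
    then have "g ` {..<m} \<subseteq> core" by auto
    moreover have "card (g ` {..<m}) = card core"
    proof -
      have "inj_on g {..<m}" using ne m(3) by (meson inj_onI lessThan_iff less_le_trans)
      then show ?thesis by (simp add: card_image m_def)
    qed
    ultimately have core: "core = g ` {..<m}" using finite_core by (metis card_subset_eq)
    have "\<forall>i\<in>core. \<forall>j\<in>core. i \<noteq> j \<longrightarrow> E i j" unfolding core using clique by auto
    moreover have "\<forall>u\<in>P. E (g 0) u"
    proof
      fix u assume u: "u \<in> P"
      then have uV: "u \<in> V" "u \<notin> core" using P_subset core_P_disjoint by auto
      then have "f u < n" using f(1) by (auto dest: bij_betwE)
      moreover have "f u \<ge> m" using uV gf[of u] unfolding core by (metis imageI lessThan_iff not_le)
      ultimately have "E (g 0) (g (f u))" using adj m by (auto simp: Knp_adj_def)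
      then show "E (g 0) u" using gf uV by simp
    qed
    moreover have "g 0 \<in> core" unfolding core using m by auto
    ultimately show "(\<forall>i\<in>core. \<forall>j\<in>core. i \<noteq> j \<longrightarrow> E i j) \<and> (\<exists>z\<in>core. \<forall>u\<in>P. E z u)" by blast
  }
  assume "(\<forall>i\<in>core. \<forall>j\<in>core. i \<noteq> j \<longrightarrow> E i j) \<and> (\<exists>z\<in>core. \<forall>u\<in>P. E z u)"
  then obtain z where clique: "\<And>i j. i \<in> core \<Longrightarrow> j \<in> core \<Longrightarrow> i \<noteq> j \<Longrightarrow> E i j"
    and z: "z \<in> core" "\<And>u. u \<in> P \<Longrightarrow> E z u" by auto
  have "card (core - {z}) = card {1..<m}" using z finite_core by (simp add: m_def)
  then obtain h1 where h1: "bij_betw h1 (core - {z}) {1..<m}"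
    using finite_core finite_same_card_bij[of "core - {z}" "{1..<m}"] by auto
  have "card P = card {m..<n}" using card_V n by (simp add: m_def)
  then obtain h2 where h2: "bij_betw h2 P {m..<n}"
    using finite_P finite_same_card_bij[of P "{m..<n}"] by auto
  define f where "f u = (if u = z then 0 else if u \<in> core then h1 u else h2 u)" for u
  have zP: "z \<notin> P" using z core_P_disjoint by auto
  have "bij_betw f {z} {0}" by (simp add: bij_betw_def f_def)
  moreover have "bij_betw f (core - {z}) {1..<m}"
    using h1 by (rule bij_betw_cong[THEN iffD1, rotated]) (auto simp: f_def)
  ultimately have "bij_betw f ({z} \<union> (core - {z})) ({0} \<union> {1..<m})"
    by (rule bij_betw_combine) auto
  moreover have "{z} \<union> (core - {z}) = core" using z by auto
  moreover have "{0} \<union> {1..<m} = {0..<m}" using m by auto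
  ultimately have f_core: "bij_betw f core {0..<m}" by simp
  have f_P: "bij_betw f P {m..<n}"
    using h2 by (rule bij_betw_cong[THEN iffD1, rotated]) (use zP core_P_disjoint in \<open>auto simp: f_def\<close>)
  have "bij_betw f (core \<union> P) ({0..<m} \<union> {m..<n})"
    using f_core f_P by (rule bij_betw_combine) auto
  moreover have "{0..<m} \<union> {m..<n} = {0..<n}" using m by auto
  ultimately have f: "bij_betw f V {0..<n}" using V_eq by simp
  have "E u v \<longleftrightarrow> Knp_adj n p (f u) (f v)" if uv: "u \<in> V" "v \<in> V" for u v
  proof -
    have lt: "f w < n" if "w \<in> V" for w using bij_betwE[OF f] that by auto
    have core_iff: "f w < m \<longleftrightarrow> w \<in> core" if "w \<in> V" for w
      using bij_betwE[OF f_core] bij_betwE[OF f_P] that by (force simp: core_def)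
    have eq_iff: "f u = f v \<longleftrightarrow> u = v" using f uv by (auto simp: bij_betw_def inj_on_eq_iff)
    have "f z = 0" by (simp add: f_def)
    moreover have "z \<in> V" using z by (auto simp: core_def)
    ultimately have zero_iff: "f w = 0 \<longleftrightarrow> w = z" if "w \<in> V" for w
      using f that by (metis bij_betw_def inj_on_eq_iff)
    have "E u v \<longleftrightarrow> u \<noteq> v \<and> (u \<in> core \<and> v \<in> core \<or> u = z \<and> v \<notin> core \<or> v = z \<and> u \<notin> core)"
    proof
      assume uvE: "E u v"
      have "u \<noteq> v" using uvE edge_irrefl by auto
      moreover have "v = z" if "u \<notin> core"
        using that uvE uv pendent_unique z edge_sym by (metis DiffI core_def)
      moreover have "u = z" if "v \<notin> core"
        using that uvE uv pendent_unique z edge_sym by (metis DiffI core_def)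
      ultimately show "u \<noteq> v \<and> (u \<in> core \<and> v \<in> core \<or> u = z \<and> v \<notin> core \<or> v = z \<and> u \<notin> core)" by blast
    next
      assume "u \<noteq> v \<and> (u \<in> core \<and> v \<in> core \<or> u = z \<and> v \<notin> core \<or> v = z \<and> u \<notin> core)"
      then show "E u v" using clique z edge_sym uv by (auto simp: core_def)
    qed
    then show ?thesis
      using lt uv core_iff eq_iff zero_iff m unfolding Knp_adj_def by (simp add: not_less[symmetric])
  qed
  then show "graph_iso V E {0..<n} (Knp_adj n p)" using f by (auto simp: graph_iso_def)
qed

end

lemma ABC_star:
  assumes "n \<ge> 1" "n \<noteq> 2"
  shows "ABC {0..<n} (star_adj n) = sqrt ((real n - 1) * (real n - 2))"
proof -
  have centre: "degree {0..<n} (star_adj n) 0 = n - 1"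
  proof -
    have "{u \<in> {0..<n}. star_adj n 0 u} = {1..<n}" using assms by (auto simp: star_adj_def)
    then show ?thesis by (simp add: degree_def)
  qed
  have leaf: "degree {0..<n} (star_adj n) i = 1" if "0 < i" "i < n" for i
  proof -
    have "{u \<in> {0..<n}. star_adj n i u} = {0}" using that by (auto simp: star_adj_def)
    then show ?thesis by (simp add: degree_def)
  qed
  have P: "pendent_vertices {0..<n} (star_adj n) = {1..<n}"
  proof -
    have "degree {0..<n} (star_adj n) i = 1 \<longleftrightarrow> i \<noteq> 0" if "i < n" for i
      using centre leaf[of i] that assms by (cases "i = 0") auto
    then show ?thesis by (auto simp: pendent_vertices_def)
  qed
  have "(star_adj n)\<^sup>*\<^sup>* u v" if "u < n" "v < n" for u v
  proof -
    have "(star_adj n)\<^sup>*\<^sup>* u 0" using that by (cases "u = 0") (auto simp: star_adj_def)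
    moreover have "(star_adj n)\<^sup>*\<^sup>* 0 v" using that by (cases "v = 0") (auto simp: star_adj_def)
    ultimately show ?thesis by (rule rtranclp_trans)
  qed
  then interpret pendent_graph "{0..<n}" "star_adj n"
    using assms P by unfold_locales (auto simp: simple_graph_def star_adj_def connected_graph_def set_eq_iff)
  have "core = {0}" using assms P by (auto simp: core_def)
  then show ?thesis using singleton_core(1) by simp
qed

theorem theorem2p4:
  fixes V :: "'a set" and E :: "'a \<Rightarrow> 'a \<Rightarrow> bool" and n p :: nat
  assumes "simple_graph V E" and "connected_graph V E"
    and "card V = n" and "card (pendent_vertices V E) = p"
  shows "(real n - real p = 1 \<longrightarrow>
            ABC V E = ABC {0..<n} (star_adj n) \<and>
            ABC V E = sqrt ((real n - 1) * (real n - 2)))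
       \<and> (real n - real p = 2 \<longrightarrow>
            ABC V E \<le> (real n - 3) * sqrt ((real n - 3) / (real n - 2)) + sqrt 2 \<and>
            (ABC V E = (real n - 3) * sqrt ((real n - 3) / (real n - 2)) + sqrt 2
               \<longleftrightarrow> graph_iso V E {0..<n} (Gprime_adj n)))
       \<and> (real n - real p > 2 \<longrightarrow>
            (let b = real p * sqrt ((real n - 2) / (real n - 1))
                   + (real n - real p - 1) * sqrt ((2 * real n - real p - 4) / ((real n - 1) * (real n - real p - 1)))
                   + (real n - real p - 1) * (real n - real p - 2) / 2
                       * sqrt ((2 * real n - 2 * real p - 4) / (real n - real p - 1)^2)
             in ABC V E \<le> b \<and> (ABC V E = b \<longleftrightarrow> graph_iso V E {0..<n} (Knp_adj n p))))"
proof (intro conjI impI)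
  have graph: "pendent_graph V E" if "p < n"
    using assms that by unfold_locales auto
  {
    assume np: "real n - real p = 1"
    then interpret pendent_graph V E by (intro graph) linarith
    have "card core = 1" using card_V np assms by linarith
    note * = singleton_core[OF this]
    then show "ABC V E = sqrt ((real n - 1) * (real n - 2))" using assms by simp
    moreover have "n \<ge> 1" "n \<noteq> 2" using np * assms by auto
    ultimately show "ABC V E = ABC {0..<n} (star_adj n)" by (simp add: ABC_star)
  }
  {
    assume np: "real n - real p = 2"
    then interpret pendent_graph V E by (intro graph) linarith
    have k: "card core = 2" using card_V np assms by linarith
    show "ABC V E \<le> (real n - 3) * sqrt ((real n - 3) / (real n - 2)) + sqrt 2"
      using double_core_ABC_le(1)[OF k] assms by simp
    show "ABC V E = (real n - 3) * sqrt ((real n - 3) / (real n - 2)) + sqrt 2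
        \<longleftrightarrow> graph_iso V E {0..<n} (Gprime_adj n)"
      using double_core_ABC_le(2)[OF k] iso_Gprime_iff[OF k] assms by simp
  }
  assume np: "real n - real p > 2"
  then interpret pendent_graph V E by (intro graph) linarith
  have k: "card core \<ge> 3" and c: "real (card core) - 1 = real n - real p - 1"
    using card_V np assms by linarith+
  have eqs: "real n - real p - 1 + real p = real n - 1"
    "real n - 1 + (real n - real p - 1) - 2 = 2 * real n - real p - 4"
    "real n - real p - 1 - 1 = real n - real p - 2"
    "real n - real p - 1 + (real n - real p - 1) - 2 = 2 * real n - 2 * real p - 4"
    "real n - 1 + 1 - 2 = real n - 2"
    by simp_all
  show "let b = real p * sqrt ((real n - 2) / (real n - 1))
         + (real n - real p - 1) * sqrt ((2 * real n - real p - 4) / ((real n - 1) * (real n - real p - 1)))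
         + (real n - real p - 1) * (real n - real p - 2) / 2
             * sqrt ((2 * real n - 2 * real p - 4) / (real n - real p - 1)^2)
       in ABC V E \<le> b \<and> (ABC V E = b \<longleftrightarrow> graph_iso V E {0..<n} (Knp_adj n p))"
    using large_core_ABC_le[OF k] iso_Knp_iff[OF k assms(3,4)]
    unfolding c assms(4) abc_weight_def eqs mult_1_right power2_eq_square Let_def by blast
qed

end
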